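(* Let $\pi_A,\pi_B,\sigma_A,\sigma_B>0$, $\zeta\in(0,1)$, $\gamma>0$, $-1\le\rho<1$, and suppose $b=\frac{\sigma_B\pi_A}{\sigma_A\pi_B}\ge 1$. Let $\psi_A=\zeta\gamma\frac{\sigma_A}{\pi_A}$, $\psi_B=\zeta\gamma\frac{\sigma_B}{\pi_B}$, $\lambda_1=1+b^2-2b\rho$, $\lambda_2=1-b\rho$, and for $n\in[0,1]$ let $$\psi(n)=\psi_A\left(\lambda_1\tilde n^2-2\lambda_2\tilde n+1\right)^{1/2},\qquad \tilde n=\frac{n\pi_B}{(1-n)\pi_A+n\pi_B}.$$ Then a competitiveness region exists for the joint pricer (that is, there exists $n\in(0,1)$ with $\psi(n)<\psi_A$) if and only if $b\rho<1$. Moreover, if $b\rho<1$, the minimum loading proportion $\psi^{\min}$ (the minimum of $\psi$ over $[0,1]$) is $$\psi^{\min}=\psi(n^{\min})=\psi_A\sqrt{\frac{\lambda_1-\lambda_2^2}{\lambda_1}}<\psi_A,\qquad\text{where } n^{\min}=\frac{\lambda_2\pi_A}{\lambda_2\pi_A+(\lambda_1-\lambda_2)\pi_B}\in(0,1),$$ whereas the maximum loading proportion (the maximum of $\psi$ over $[0,1]$) is $\psi^{\max}=\psi(1)=\psi_B$. For $b\rho=1$, the expression $\frac{\lambda_2\pi_A}{\lambda_2\pi_A+(\lambda_1-\lambda_2)\pi_B}$ for $n^{\min}$ equals $0$.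
   Context: Two insurance business lines $A$ and $B$ have per-policy random present values of payouts $V_A,V_B$ with positive finite means $\pi_A,\pi_B$, positive finite standard deviations $\sigma_A,\sigma_B$ and correlation coefficient $\rho\in[-1,1)$. Without loss of generality $b=\frac{\sigma_B\pi_A}{\sigma_A\pi_B}\ge1$. Risk is measured by the mean-standard deviation risk measure $\varphi[V]=E[V]+\gamma\,\mathrm{sd}(V)$, $\gamma>0$, and $\zeta\in(0,1)$ is a risk reduction factor. $\psi_A,\psi_B$ are the stand-alone proportional loadings (so $\psi_A\le\psi_B$). $\psi(n)$ is the common proportional loading required when both lines are priced jointly and $n$ is the proportion of policies sold in line $B$; it satisfies $\psi(0)=\psi_A$ and $\psi(1)=\psi_B$. A competitiveness region is said to exist if there are values $n\in(0,1)$ with $\psi(n)<\psi_A$ (and hence also $\psi(n)<\psi_B$). *)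

theory Defs imports Complex_Main begin

end

(* With premium share t = n~, the radicand is q t = l1 t^2 - 2 l2 t + 1 = (1 - t)^2 + 2 b rho t (1 - t) + b^2 t^2,
   the variance of the pooled portfolio relative to line A.  It is strictly convex with vertex l2 / l1,
   q 0 = 1 and q 1 = b^2 >= 1, so it is largest at t = 1, and it drops below 1 on (0, 1) exactly when
   its vertex is positive, that is when b rho < 1.  The map from n to t is a bijection of [0, 1],
   and it sends nmin to the vertex. *)

theory Submission imports Defs begin

text \<open>Completing the square: the gap between the two sides is
  \<open>(a * t - c)\<^sup>2 / a\<close>.\<close>

lemma quadratic_ge_vertex:
  fixes a c t :: real
  assumes "a > 0"
  shows "(a - c\<^sup>2) / a \<le> a * t\<^sup>2 - 2 * c * t + 1"
proof -
  have "a * t\<^sup>2 - 2 * c * t + 1 - (a - c\<^sup>2) / a = (a * t - c)\<^sup>2 / a"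
    using assms by (simp add: field_simps power2_eq_square)
  then show ?thesis
    using assms by (smt (verit) divide_nonneg_pos zero_le_power2)
qed

lemma quadratic_at_vertex:
  fixes a c :: real
  assumes "a \<noteq> 0"
  shows "a * (c / a)\<^sup>2 - 2 * c * (c / a) + 1 = (a - c\<^sup>2) / a"
  using assms by (simp add: field_simps power2_eq_square)

text \<open>The gap has the root \<open>t = 1\<close>, and its cofactor
  \<open>a * t + (a - 2 * c)\<close> is nonnegative. The condition \<open>a \<ge> 2 * c\<close> says
  that the value at 1 is at least the value 1 at 0.\<close>

lemma convex_quadratic_le_right_end:
  fixes a c t :: real
  assumes "a \<ge> 0" "0 \<le> t" "t \<le> 1" "a \<ge> 2 * c"
  shows "a * t\<^sup>2 - 2 * c * t + 1 \<le> a - 2 * c + 1"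
proof -
  have "a - 2 * c + 1 - (a * t\<^sup>2 - 2 * c * t + 1) = (1 - t) * (a * t + (a - 2 * c))"
    by (simp add: algebra_simps power2_eq_square)
  moreover have "\<dots> \<ge> 0"
    using assms by (intro mult_nonneg_nonneg add_nonneg_nonneg) auto
  ultimately show ?thesis by linarith
qed

lemma weighted_share_bounds:
  fixes p q n :: real
  assumes "p > 0" "q > 0" "0 \<le> n" "n \<le> 1"
  shows "0 \<le> n * q / ((1 - n) * p + n * q)" "n * q / ((1 - n) * p + n * q) \<le> 1"
proof -
  have "(1 - n) * p + n * q > 0"
    using assms by (cases "n = 0") (auto intro: add_nonneg_pos)
  moreover have "(1 - n) * p \<ge> 0"
    using assms by simp
  ultimately show "0 \<le> n * q / ((1 - n) * p + n * q)" "n * q / ((1 - n) * p + n * q) \<le> 1"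
    using assms by auto
qed

text \<open>Inverts the map from policy share to premium share: weighting \<open>u\<close> by
  \<open>p\<close> and \<open>v\<close> by \<open>q\<close> makes both premium volumes multiples of
  \<open>p * q / D\<close>, which cancels and leaves the ratio \<open>u : v\<close>.\<close>

lemma weighted_share_inverse:
  fixes p q u v :: real
  defines "n \<equiv> u * p / (u * p + v * q)"
  assumes "p > 0" "q > 0" "u > 0" "v > 0"
  shows "n * q / ((1 - n) * p + n * q) = u / (u + v)"
proof -
  define D where "D = u * p + v * q"
  have D: "D > 0"
    unfolding D_def using assms by (simp add: add_pos_pos)
  have n: "n = u * p / D"
    by (simp add: n_def D_def)
  have m: "1 - n = v * q / D"
    using D by (simp add: n field_simps D_def)
  have "(1 - n) * p + n * q = (u + v) * (p * q / D)"
    unfolding m unfolding n by (simp add: add_divide_distrib algebra_simps)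
  moreover have "n * q = u * (p * q / D)"
    by (simp add: n)
  ultimately show ?thesis
    using D assms by simp
qed

theorem lemma3p1:
  fixes \<pi>\<^sub>A \<pi>\<^sub>B \<sigma>\<^sub>A \<sigma>\<^sub>B \<zeta> \<gamma> \<rho> b \<psi>\<^sub>A \<psi>\<^sub>B l\<^sub>1 l\<^sub>2 n\<^sub>m\<^sub>i\<^sub>n :: real
    and \<psi> nt :: "real \<Rightarrow> real"
  assumes "\<pi>\<^sub>A > 0" "\<pi>\<^sub>B > 0" "\<sigma>\<^sub>A > 0" "\<sigma>\<^sub>B > 0"
    and "0 < \<zeta>" "\<zeta> < 1" "\<gamma> > 0" "-1 \<le> \<rho>" "\<rho> < 1"
    and "b = (\<sigma>\<^sub>B * \<pi>\<^sub>A) / (\<sigma>\<^sub>A * \<pi>\<^sub>B)" "b \<ge> 1"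
    and "\<psi>\<^sub>A = \<zeta> * \<gamma> * (\<sigma>\<^sub>A / \<pi>\<^sub>A)" "\<psi>\<^sub>B = \<zeta> * \<gamma> * (\<sigma>\<^sub>B / \<pi>\<^sub>B)"
    and "l\<^sub>1 = 1 + b\<^sup>2 - 2 * b * \<rho>" "l\<^sub>2 = 1 - b * \<rho>"
    and "\<And>n. n \<in> {0..1} \<Longrightarrow> nt n = n * \<pi>\<^sub>B / ((1 - n) * \<pi>\<^sub>A + n * \<pi>\<^sub>B)"
    and "\<And>n. n \<in> {0..1} \<Longrightarrow> \<psi> n = \<psi>\<^sub>A * sqrt (l\<^sub>1 * (nt n)\<^sup>2 - 2 * l\<^sub>2 * nt n + 1)"
    and "n\<^sub>m\<^sub>i\<^sub>n = l\<^sub>2 * \<pi>\<^sub>A / (l\<^sub>2 * \<pi>\<^sub>A + (l\<^sub>1 - l\<^sub>2) * \<pi>\<^sub>B)"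
  shows "((\<exists>n\<in>{0<..<1}. \<psi> n < \<psi>\<^sub>A) \<longleftrightarrow> b * \<rho> < 1) \<and>
    (b * \<rho> < 1 \<longrightarrow>
       n\<^sub>m\<^sub>i\<^sub>n \<in> {0<..<1} \<and>
       is_arg_min \<psi> (\<lambda>n. n \<in> {0..1}) n\<^sub>m\<^sub>i\<^sub>n \<and>
       \<psi> n\<^sub>m\<^sub>i\<^sub>n = \<psi>\<^sub>A * sqrt ((l\<^sub>1 - l\<^sub>2\<^sup>2) / l\<^sub>1) \<and>
       \<psi>\<^sub>A * sqrt ((l\<^sub>1 - l\<^sub>2\<^sup>2) / l\<^sub>1) < \<psi>\<^sub>A \<and>
       is_arg_max \<psi> (\<lambda>n. n \<in> {0..1}) 1 \<and>
       \<psi> 1 = \<psi>\<^sub>B) \<and>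
    (b * \<rho> = 1 \<longrightarrow>
       l\<^sub>2 * \<pi>\<^sub>A + (l\<^sub>1 - l\<^sub>2) * \<pi>\<^sub>B \<noteq> 0 \<and> n\<^sub>m\<^sub>i\<^sub>n = 0)"
proof -
  note psi = assms(17) and nt = assms(16)
  define q where "q t = l\<^sub>1 * t\<^sup>2 - 2 * l\<^sub>2 * t + 1" for t
  have pA: "\<psi>\<^sub>A > 0"
    using assms by simp
  have pB: "\<psi>\<^sub>B = \<psi>\<^sub>A * b"
    using assms(1-4) by (simp add: assms(10,12,13))
  have b: "b > 0"
    using assms(11) by simp
  \<comment> \<open>This splitting isolates \<open>1 - \<rho>\<close>, so that
    \<open>\<rho> < 1\<close> gives strict positivity even when \<open>b = 1\<close>.\<close>
  have "l\<^sub>1 = (1 - b)\<^sup>2 + 2 * b * (1 - \<rho>)"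
    by (simp add: assms(14) power2_eq_square algebra_simps)
  then have l1: "l\<^sub>1 > 0"
    using b assms(9) by (simp add: add_nonneg_pos)
  have "l\<^sub>1 - l\<^sub>2 = b * (b - \<rho>)"
    by (simp add: assms(14,15) power2_eq_square algebra_simps)
  then have l12: "l\<^sub>1 - l\<^sub>2 > 0"
    using b assms(9,11) by simp
  have q_right: "l\<^sub>1 - 2 * l\<^sub>2 + 1 = b\<^sup>2"
    by (simp add: assms(14,15))
  \<comment> \<open>By \<open>q_right\<close> this is \<open>l\<^sub>1 \<ge> 2 * l\<^sub>2\<close>,
    the endpoint condition of the convexity lemma.\<close>
  have "b\<^sup>2 \<ge> 1"
    using assms(11) by simp
  then have q_le: "q t \<le> b\<^sup>2" if "0 \<le> t" "t \<le> 1" for t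
    using convex_quadratic_le_right_end[of l\<^sub>1 t l\<^sub>2] that l1 q_right by (simp add: q_def)
  have psi_q: "\<psi> n = \<psi>\<^sub>A * sqrt (q (nt n))" if "n \<in> {0..1}" for n
    using psi[OF that] by (simp add: q_def)
  have nt01: "0 \<le> nt n" "nt n \<le> 1" if "n \<in> {0..1}" for n
    using weighted_share_bounds[of \<pi>\<^sub>A \<pi>\<^sub>B n] that assms(1,2) nt[OF that] by auto
  have psi1: "\<psi> 1 = \<psi>\<^sub>B"
  proof -
    have "nt 1 = 1"
      using nt[of 1] assms(2) by simp
    then show ?thesis
      using psi[of 1] q_right b pB by simp
  qed
  have necessary: "b * \<rho> < 1" if n: "n \<in> {0<..<1}" and less: "\<psi> n < \<psi>\<^sub>A" for n
  proof -
    have n': "n \<in> {0..1}"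
      using n by simp
    \<comment> \<open>\<open>sqrt\<close> is strictly increasing on all reals, so loadings compare
      as their radicands do. A radicand below 1 forces the linear term to outweigh the square, hence
      \<open>l\<^sub>2 > 0\<close>.\<close>
    have "q (nt n) < 1"
      using less pA by (simp add: psi_q[OF n'])
    moreover have "l\<^sub>1 * (nt n)\<^sup>2 \<ge> 0"
      using l1 by simp
    ultimately have "0 < l\<^sub>2 * nt n"
      by (simp add: q_def)
    then show ?thesis
      using nt01(1)[OF n'] by (simp add: zero_less_mult_iff assms(15))
  qed
  have main: "n\<^sub>m\<^sub>i\<^sub>n \<in> {0<..<1} \<and> is_arg_min \<psi> (\<lambda>n. n \<in> {0..1}) n\<^sub>m\<^sub>i\<^sub>n \<and>
      \<psi> n\<^sub>m\<^sub>i\<^sub>n = \<psi>\<^sub>A * sqrt ((l\<^sub>1 - l\<^sub>2\<^sup>2) / l\<^sub>1) \<and>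
      \<psi>\<^sub>A * sqrt ((l\<^sub>1 - l\<^sub>2\<^sup>2) / l\<^sub>1) < \<psi>\<^sub>A"
    if "b * \<rho> < 1"
  proof -
    have l2: "l\<^sub>2 > 0"
      using that by (simp add: assms(15))
    have "l\<^sub>2 * \<pi>\<^sub>A > 0" "(l\<^sub>1 - l\<^sub>2) * \<pi>\<^sub>B > 0"
      using l2 l12 assms(1,2) by simp_all
    then have nmin: "n\<^sub>m\<^sub>i\<^sub>n \<in> {0<..<1}"
      by (simp add: assms(18))
    then have nmin': "n\<^sub>m\<^sub>i\<^sub>n \<in> {0..1}"
      by simp
    \<comment> \<open>Taking \<open>u = l\<^sub>2\<close> and
      \<open>v = l\<^sub>1 - l\<^sub>2\<close> makes \<open>u + v = l\<^sub>1\<close>, so the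
      premium share is the vertex.\<close>
    have "nt n\<^sub>m\<^sub>i\<^sub>n = l\<^sub>2 / l\<^sub>1"
      unfolding nt[OF nmin'] unfolding assms(18)
      using weighted_share_inverse[OF assms(1,2) l2 l12] by simp
    then have min: "\<psi> n\<^sub>m\<^sub>i\<^sub>n = \<psi>\<^sub>A * sqrt ((l\<^sub>1 - l\<^sub>2\<^sup>2) / l\<^sub>1)"
      using quadratic_at_vertex[of l\<^sub>1 l\<^sub>2] l1 psi[OF nmin'] by simp
    have "(l\<^sub>1 - l\<^sub>2\<^sup>2) / l\<^sub>1 < 1"
      using l1 l2 by simp
    then have less: "\<psi>\<^sub>A * sqrt ((l\<^sub>1 - l\<^sub>2\<^sup>2) / l\<^sub>1) < \<psi>\<^sub>A"
      using pA by simp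
    have "\<psi> n\<^sub>m\<^sub>i\<^sub>n \<le> \<psi> n" if "n \<in> {0..1}" for n
      unfolding min psi[OF that] using quadratic_ge_vertex[OF l1] pA by simp
    then have "is_arg_min \<psi> (\<lambda>n. n \<in> {0..1}) n\<^sub>m\<^sub>i\<^sub>n"
      using nmin' by (simp add: is_arg_min_linorder)
    then show ?thesis
      using nmin min less by blast
  qed
  have "\<psi> n \<le> \<psi> 1" if "n \<in> {0..1}" for n
  proof -
    have "sqrt (q (nt n)) \<le> b"
      using q_le[OF nt01[OF that]] b by (simp add: real_le_lsqrt)
    then show ?thesis
      using psi1 pB pA psi_q[OF that] by simp
  qed
  then have max: "is_arg_max \<psi> (\<lambda>n. n \<in> {0..1}) 1"
    by (simp add: is_arg_max_linorder)
  \<comment> \<open>Here \<open>l\<^sub>2 = 0\<close> while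
    \<open>l\<^sub>1 - l\<^sub>2 > 0\<close>, so the zero is a genuine quotient and not the default
    value of division by zero.\<close>
  have "l\<^sub>2 * \<pi>\<^sub>A + (l\<^sub>1 - l\<^sub>2) * \<pi>\<^sub>B \<noteq> 0 \<and> n\<^sub>m\<^sub>i\<^sub>n = 0" if "b * \<rho> = 1"
    using that l12 assms(2) by (simp add: assms(15,18))
  \<comment> \<open>For the existence of a competitiveness region,
    \<open>n\<^sub>m\<^sub>i\<^sub>n\<close> from \<open>main\<close> is the witness.\<close>
  then show ?thesis
    using necessary main max psi1 by metis
qed

end
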